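(* Let $P=\omega_0P_0+\omega_1P_1+\omega_2P_2$, where $P_0,P_1,P_2$ are the polynomials defined in the context from the cell averages of $u$, and where the ($h$-dependent) weights satisfy $\omega_i\ge0$, $\omega_0+\omega_1+\omega_2=1$. Let $u$ be smooth in $S_0=I_{0.5}$ and contain a discontinuity, located at $x^*$, in $I_{1.5}$. If, as $h\to0$, $$\omega_0=O(1),\qquad \omega_1=O(h),\qquad \omega_2=O(h),$$ then $$u(x)-P(x)=O(h)\qquad\forall x\in S_0,$$ and this estimate even holds for all $x$ up to the position $x^*$ of the discontinuity (i.e. for all $x\in[x_0,x^* )$) if $u$ is sufficiently smooth there.
   Context: Grid: $h>0$ is the mesh size, $x_0\in\mathbb{R}$ the left boundary point, $x_j=x_0+jh$ (for integer and half-integer $j$), and for $j\in\{0.5,1.5,2.5\}$ the cells are $I_j=[x_j-\tfrac h2,x_j+\tfrac h2]$. Stencils: $S_0=I_{0.5}$, $S_1=I_{0.5}\cup I_{1.5}$, $S_2=I_{0.5}\cup I_{1.5}\cup I_{2.5}$. Cell averages: $\bar u_j=\frac1h\int_{I_j}u(x)\,dx$. Polynomials: with $\sigma_l=\bar u_{1.5}-\bar u_{0.5}$ and $\sigma_r=\bar u_{2.5}-\bar u_{1.5}$, $$P_0(x)=\bar u_{0.5},\qquad P_1(x)=\bar u_{1.5}+\frac{\sigma_l}{h}(x-x_{1.5}),$$ $$P_2(x)=\frac1{c_2}\Big(-c_0\bar u_{0.5}+(1-c_1)\bar u_{1.5}-\tfrac1{24}(\sigma_r-\sigma_l)+\frac{\sigma_r+\sigma_l-2c_1\sigma_l}{2h}(x-x_{1.5})+\frac{\sigma_r-\sigma_l}{2h^2}(x-x_{1.5})^2\Big),$$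 where $c_0=K_0h^{\gamma_0}$, $c_1=K_1h^{\gamma_1}$, $c_2=1-K_0h^{\gamma_0}-K_1h^{\gamma_1}$ with fixed $K_0,K_1\in\mathbb{R}_{>0}$, $\gamma_0,\gamma_1\in\mathbb{R}_{\ge0}$, $\gamma_0\ge\gamma_1$, $\gamma_0\ge1$, and $c_i>0$ for all sufficiently small $h$. Asymptotics: all $O(\cdot)$ are for $h\to0$ with $u$ and the parameters fixed, and estimates in $x$ are uniform. The function $u$ is fixed, bounded, and has near $x^*$ a single (jump) discontinuity, at $x^*$, being smooth on both sides of it; the grid origin $x_0=x_0(h)$ depends on $h$ so that $x^*$ lies in $I_{1.5}$ for every $h$ under consideration (for instance $x_0=x^*-1.5h$). Smoothness on the $h$-dependent stencil means $C^k$ with $k$ sufficiently large and with derivative bounds uniform in $h$. *)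

theory Defs
  imports "HOL-Analysis.Analysis" "HOL-Library.Landau_Symbols"
begin

text \<open>The grid is given by its left boundary point \<open>x0\<close> and mesh size \<open>h\<close>. The index \<open>j\<close> is real,
  since integer and half-integer indices both occur.\<close>

definition grid_pt :: "real \<Rightarrow> real \<Rightarrow> real \<Rightarrow> real" where
  "grid_pt x0 h j = x0 + j * h"

definition cell :: "real \<Rightarrow> real \<Rightarrow> real \<Rightarrow> real set" where
  "cell x0 h j = {grid_pt x0 h j - h / 2 .. grid_pt x0 h j + h / 2}"

definition cell_avg :: "(real \<Rightarrow> real) \<Rightarrow> real \<Rightarrow> real \<Rightarrow> real \<Rightarrow> real" where
  "cell_avg u x0 h j = (1 / h) * integral (cell x0 h j) u"

definition sigma_l :: "(real \<Rightarrow> real) \<Rightarrow> real \<Rightarrow> real \<Rightarrow> real" where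
  "sigma_l u x0 h = cell_avg u x0 h (3/2) - cell_avg u x0 h (1/2)"

definition sigma_r :: "(real \<Rightarrow> real) \<Rightarrow> real \<Rightarrow> real \<Rightarrow> real" where
  "sigma_r u x0 h = cell_avg u x0 h (5/2) - cell_avg u x0 h (3/2)"

definition P0 :: "(real \<Rightarrow> real) \<Rightarrow> real \<Rightarrow> real \<Rightarrow> real \<Rightarrow> real" where
  "P0 u x0 h x = cell_avg u x0 h (1/2)"

definition P1 :: "(real \<Rightarrow> real) \<Rightarrow> real \<Rightarrow> real \<Rightarrow> real \<Rightarrow> real" where
  "P1 u x0 h x =
     cell_avg u x0 h (3/2) + sigma_l u x0 h / h * (x - grid_pt x0 h (3/2))"

definition P2 :: "real \<Rightarrow> real \<Rightarrow> real \<Rightarrow> (real \<Rightarrow> real) \<Rightarrow> real \<Rightarrow> real \<Rightarrow> real \<Rightarrow> real" where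
  "P2 c0 c1 c2 u x0 h x =
     (1 / c2) *
       (- c0 * cell_avg u x0 h (1/2)
        + (1 - c1) * cell_avg u x0 h (3/2)
        - (1/24) * (sigma_r u x0 h - sigma_l u x0 h)
        + (sigma_r u x0 h + sigma_l u x0 h - 2 * c1 * sigma_l u x0 h) / (2 * h)
            * (x - grid_pt x0 h (3/2))
        + (sigma_r u x0 h - sigma_l u x0 h) / (2 * h\<^sup>2) * (x - grid_pt x0 h (3/2))\<^sup>2)"

text \<open>\<open>Ck_derivs k u S D\<close>: \<open>u\<close> is \<open>k\<close> times continuously differentiable on \<open>S\<close>, and \<open>D i\<close> is its \<open>i\<close>-th
  derivative there. Derivatives are taken within \<open>S\<close>, hence are one-sided at an endpoint of an
  interval that belongs to it, and only the values of \<open>u\<close> on \<open>S\<close> matter.\<close>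

definition Ck_derivs ::
    "nat \<Rightarrow> (real \<Rightarrow> real) \<Rightarrow> real set \<Rightarrow> (nat \<Rightarrow> real \<Rightarrow> real) \<Rightarrow> bool" where
  "Ck_derivs k u S D \<longleftrightarrow>
     (\<forall>x\<in>S. D 0 x = u x) \<and>
     (\<forall>i<k. \<forall>x\<in>S. (D i has_real_derivative D (Suc i) x) (at x within S)) \<and>
     continuous_on S (D k)"

definition Ck_on :: "nat \<Rightarrow> (real \<Rightarrow> real) \<Rightarrow> real set \<Rightarrow> bool" where
  "Ck_on k u S \<longleftrightarrow> (\<exists>D. Ck_derivs k u S D)"

text \<open>Smoothness on sets \<open>S h\<close> depending on the mesh size: the bound \<open>B\<close> for the derivatives does not
  depend on \<open>h\<close>.\<close>

definition Ck_uniformly_on :: "nat \<Rightarrow> (real \<Rightarrow> real) \<Rightarrow> (real \<Rightarrow> real set) \<Rightarrow> bool" where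
  "Ck_uniformly_on k u S \<longleftrightarrow>
     (\<exists>B. \<forall>\<^sub>F h in at_right 0. \<exists>D. Ck_derivs k u (S h) D \<and> (\<forall>i\<le>k. \<forall>x\<in>S h. \<bar>D i x\<bar> \<le> B))"

definition jump_at :: "(real \<Rightarrow> real) \<Rightarrow> real \<Rightarrow> bool" where
  "jump_at u a \<longleftrightarrow>
     (\<exists>l r. (u \<longlongrightarrow> l) (at_left a) \<and> (u \<longlongrightarrow> r) (at_right a) \<and> l \<noteq> r)"

text \<open>The estimate \<open>f h x = O(g h)\<close> for \<open>h\<close> tending to \<open>0\<close> from above, uniformly in \<open>x \<in> S h\<close>.\<close>

definition uniform_bigo :: "(real \<Rightarrow> real set) \<Rightarrow> (real \<Rightarrow> real \<Rightarrow> real) \<Rightarrow> (real \<Rightarrow> real) \<Rightarrow> bool" where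
  "uniform_bigo S f g \<longleftrightarrow> (\<exists>C. \<forall>\<^sub>F h in at_right 0. \<forall>x\<in>S h. \<bar>f h x\<bar> \<le> C * \<bar>g h\<bar>)"

end

theory Submission
  imports Defs
begin

text \<open>Since the weights sum to one,
  \<open>u - P = \<omega>0 (u - P0) + \<omega>1 (u - P1) + \<omega>2 (u - P2)\<close>, and the terms are small for two different reasons.

  The first one is small because of \<open>u - P0\<close>: the value of \<open>P0\<close> is the average of \<open>u\<close> over a cell on
  which \<open>u\<close> is Lipschitz with a constant independent of \<open>h\<close> (\<open>cell_avg_near_value\<close>); and \<open>u\<close> moves by
  only another \<open>O(h)\<close> between the left grid point and the discontinuity, provided that it is
  Lipschitz there as well.

  The other two are small because of the weights: the stencils of \<open>P1\<close> and \<open>P2\<close> cross the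
  discontinuity, so these polynomials do not approximate \<open>u\<close>, but they stay bounded on the first
  two cells as \<open>h\<close> tends to \<open>0\<close> (\<open>P1_bound\<close>, \<open>P2_bound\<close>). Each undivided difference \<open>\<sigma>\<close> of averages
  is bounded, and the powers of \<open>1 / h\<close> are compensated by powers of
  \<open>x - grid_pt x0 h (3/2) = O(h)\<close>. The factor \<open>1 / c2\<close> in \<open>P2\<close> is harmless because \<open>c2\<close> approaches
  its limit from below, so that positivity of \<open>c2\<close> makes the limit positive
  (\<open>c2_bounded_below\<close>).\<close>

section \<open>Lipschitz bounds from uniform smoothness\<close>

lemma Ck_derivs_imp_lipschitz:
  assumes "Ck_derivs k u S D" "k \<ge> 1" "convex S" "\<And>i x. i \<le> k \<Longrightarrow> x \<in> S \<Longrightarrow> \<bar>D i x\<bar> \<le> B"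
    and "x \<in> S" "y \<in> S"
  shows "\<bar>u x - u y\<bar> \<le> B * \<bar>x - y\<bar>"
proof -
  have d: "(D 0 has_field_derivative D 1 z) (at z within S)" if "z \<in> S" for z
    using assms(1,2) that unfolding Ck_derivs_def by auto
  have "norm (D 0 x - D 0 y) \<le> B * norm (x - y)"
    by (rule field_differentiable_bound[OF assms(3) d]) (use assms in auto)
  moreover have "D 0 x = u x" "D 0 y = u y"
    using assms unfolding Ck_derivs_def by auto
  ultimately show ?thesis by simp
qed

lemma Ck_uniformly_on_imp_lipschitz:
  assumes "Ck_uniformly_on k u S" "k \<ge> 1" "\<And>h. convex (S h)"
  obtains B where "B \<ge> 0"
    "\<forall>\<^sub>F h in at_right 0. \<forall>x\<in>S h. \<forall>y\<in>S h. \<bar>u x - u y\<bar> \<le> B * \<bar>x - y\<bar>"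
proof -
  obtain B where B: "\<forall>\<^sub>F h in at_right 0.
      \<exists>D. Ck_derivs k u (S h) D \<and> (\<forall>i\<le>k. \<forall>x\<in>S h. \<bar>D i x\<bar> \<le> B)"
    using assms(1) unfolding Ck_uniformly_on_def by blast
  \<comment> \<open>The bound may be negative if the sets \<open>S h\<close> are empty.\<close>
  have "\<forall>\<^sub>F h in at_right 0. \<forall>x\<in>S h. \<forall>y\<in>S h. \<bar>u x - u y\<bar> \<le> max B 0 * \<bar>x - y\<bar>"
    using B
  proof eventually_elim
    case (elim h)
    then obtain D where D: "Ck_derivs k u (S h) D" "\<forall>i\<le>k. \<forall>x\<in>S h. \<bar>D i x\<bar> \<le> B" by blast
    show ?case
    proof (intro ballI)
      fix x y assume "x \<in> S h" "y \<in> S h"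
      then show "\<bar>u x - u y\<bar> \<le> max B 0 * \<bar>x - y\<bar>"
        using D(2) by (intro Ck_derivs_imp_lipschitz[OF D(1) assms(2,3)]) fastforce+
    qed
  qed
  then show ?thesis by (intro that[of "max B 0"]) auto
qed

section \<open>Cell averages\<close>

lemma cell_half_eq: "cell x0 h (1/2) = {x0..x0 + h}"
  by (simp add: cell_def grid_pt_def)

lemma cell_three_halves_eq: "cell x0 h (3/2) = {x0 + h..x0 + 2 * h}"
  by (simp add: cell_def grid_pt_def)

text \<open>A function that is not integrable has integral \<open>0\<close>, which obeys the same bound.\<close>

lemma cell_avg_bounded:
  assumes "\<And>x. \<bar>u x\<bar> \<le> M" "h > 0"
  shows "\<bar>cell_avg u x0 h j\<bar> \<le> M"
proof -
  have M: "M \<ge> 0" using assms(1)[of 0] by linarith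
  have "\<bar>integral (cell x0 h j) u\<bar> \<le> M * h"
  proof (cases "u integrable_on cell x0 h j")
    case True
    then have "norm (integral (cell x0 h j) u) \<le> M * measure lborel (cell x0 h j)"
      unfolding cell_def box_real[symmetric]
      by (intro has_integral_bound[OF M integrable_integral]) (use assms in auto)
    then show ?thesis using assms(2) by (simp add: cell_def)
  next
    case False
    then show ?thesis using M assms(2) by (simp add: not_integrable_integral)
  qed
  then show ?thesis
    using assms(2) by (simp add: cell_avg_def abs_mult field_simps)
qed

lemma cell_avg_near_value:
  assumes lip: "\<And>x y. x \<in> cell x0 h j \<Longrightarrow> y \<in> cell x0 h j \<Longrightarrow> \<bar>u x - u y\<bar> \<le> B * \<bar>x - y\<bar>"
    and "B \<ge> 0" "h > 0" "x \<in> cell x0 h j"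
  shows "\<bar>u x - cell_avg u x0 h j\<bar> \<le> B * h"
proof -
  let ?a = "grid_pt x0 h j - h / 2" and ?b = "grid_pt x0 h j + h / 2"
  have "B-lipschitz_on {?a..?b} u"
    using assms by (intro lipschitz_onI) (auto simp: dist_real_def cell_def)
  then have "continuous_on {?a..?b} u" by (rule lipschitz_on_continuous_on)
  then have int: "u integrable_on {?a..?b}" by (rule integrable_continuous_real)
  have near: "\<bar>u y - u x\<bar> \<le> B * h" if "y \<in> {?a..?b}" for y
  proof -
    have "\<bar>u y - u x\<bar> \<le> B * \<bar>y - x\<bar>" using lip[of y x] that assms(4) by (simp add: cell_def)
    also have "\<dots> \<le> B * h"
      using that assms(2,3,4) by (intro mult_left_mono) (auto simp: cell_def)
    finally show ?thesis .
  qed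
  have "((\<lambda>y. u y - u x) has_integral (integral {?a..?b} u - h * u x)) {?a..?b}"
    using has_integral_diff[OF integrable_integral[OF int] has_integral_const_real[of "u x" ?a ?b]]
      assms(3) by simp
  then have "norm (integral {?a..?b} u - h * u x) \<le> (B * h) * measure lborel {?a..?b}"
    using near assms by (intro has_integral_bound_real[where f = "\<lambda>y. u y - u x"]) auto
  then have bd: "\<bar>integral {?a..?b} u - h * u x\<bar> \<le> (B * h) * h"
    using assms(3) by simp
  have "u x - cell_avg u x0 h j = - (integral {?a..?b} u - h * u x) / h"
    using assms(3) by (simp add: cell_avg_def cell_def field_simps)
  then have "\<bar>u x - cell_avg u x0 h j\<bar> = \<bar>integral {?a..?b} u - h * u x\<bar> / h"
    using assms(3) by (simp only: abs_divide abs_minus_cancel abs_of_pos)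
  also have "\<dots> \<le> B * h"
    using bd assms(3) by (simp add: field_simps)
  finally show ?thesis .
qed

section \<open>Boundedness of the linear and quadratic polynomials\<close>

lemma abs_mult_le:
  fixes a b A B :: real
  assumes "\<bar>a\<bar> \<le> A" "\<bar>b\<bar> \<le> B"
  shows "\<bar>a * b\<bar> \<le> A * B"
  unfolding abs_mult using assms by (intro mult_mono) auto

lemma scaled_distance_to_middle:
  assumes "x \<in> {x0..x0 + 2 * h}" "h > 0"
  shows "\<bar>(x - grid_pt x0 h (3/2)) / h\<bar> \<le> 3/2"
  using assms by (auto simp: grid_pt_def abs_le_iff field_simps)

text \<open>\<open>P1\<close> is a polynomial in the scaled variable \<open>(x - grid_pt x0 h (3/2)) / h\<close> whose coefficients
  depend on \<open>h\<close> only through the bounded cell averages.\<close>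

lemma P1_bound:
  assumes "\<And>x. \<bar>u x\<bar> \<le> M" "h > 0" "x \<in> {x0..x0 + 2 * h}"
  shows "\<bar>P1 u x0 h x\<bar> \<le> 4 * M"
proof -
  define t where "t = (x - grid_pt x0 h (3/2)) / h"
  have t: "\<bar>t\<bar> \<le> 3/2" unfolding t_def using assms(2,3) by (intro scaled_distance_to_middle) auto
  have avg: "\<bar>cell_avg u x0 h j\<bar> \<le> M" for j
    using assms(1,2) by (intro cell_avg_bounded)
  have "\<bar>sigma_l u x0 h\<bar> \<le> 2 * M"
    using avg[of "1/2"] avg[of "3/2"] unfolding sigma_l_def by linarith
  then have "\<bar>sigma_l u x0 h * t\<bar> \<le> 2 * M * (3/2)" using t by (rule abs_mult_le)
  moreover have "P1 u x0 h x = cell_avg u x0 h (3/2) + sigma_l u x0 h * t"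
    by (simp add: P1_def t_def)
  ultimately show ?thesis using avg[of "3/2"] by linarith
qed

text \<open>The same scaling shows that \<open>c2 * P2\<close> is bounded. Adding up the bounds of its five terms gives
  \<open>38/3 * M\<close>, which is rounded up.\<close>

lemma P2_bound:
  assumes "\<And>x. \<bar>u x\<bar> \<le> M" "h > 0" "x \<in> {x0..x0 + 2 * h}"
    and c: "0 \<le> c0" "c0 \<le> 1" "0 \<le> c1" "c1 \<le> 1" "0 < a" "a \<le> c2"
  shows "\<bar>P2 c0 c1 c2 u x0 h x\<bar> \<le> 14 * M / a"
proof -
  define t where "t = (x - grid_pt x0 h (3/2)) / h"
  have t: "\<bar>t\<bar> \<le> 3/2" unfolding t_def using assms(2,3) by (intro scaled_distance_to_middle) auto
  have t2: "\<bar>t\<^sup>2\<bar> \<le> 9/4"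
    using abs_mult_le[OF t t] by (simp add: power2_eq_square)
  have avg: "\<bar>cell_avg u x0 h j\<bar> \<le> M" for j
    using assms(1,2) by (intro cell_avg_bounded)
  have sl: "\<bar>sigma_l u x0 h\<bar> \<le> 2 * M"
    using avg[of "1/2"] avg[of "3/2"] unfolding sigma_l_def by linarith
  have sr: "\<bar>sigma_r u x0 h\<bar> \<le> 2 * M"
    using avg[of "5/2"] avg[of "3/2"] unfolding sigma_r_def by linarith
  define A where "A = - c0 * cell_avg u x0 h (1/2) + (1 - c1) * cell_avg u x0 h (3/2)
        - (1/24) * (sigma_r u x0 h - sigma_l u x0 h)
        + (sigma_r u x0 h + sigma_l u x0 h - 2 * (c1 * sigma_l u x0 h)) / 2 * t
        + (sigma_r u x0 h - sigma_l u x0 h) / 2 * t\<^sup>2"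
  have eq: "P2 c0 c1 c2 u x0 h x = 1 / c2 * A"
    by (simp add: P2_def A_def t_def power_divide)
  have A1: "\<bar>- c0 * cell_avg u x0 h (1/2)\<bar> \<le> 1 * M"
    using c avg by (intro abs_mult_le) auto
  have A2: "\<bar>(1 - c1) * cell_avg u x0 h (3/2)\<bar> \<le> 1 * M"
    using c avg by (intro abs_mult_le) auto
  have A3: "\<bar>(1/24) * (sigma_r u x0 h - sigma_l u x0 h)\<bar> \<le> 1/24 * (4 * M)"
    using sl sr by (intro abs_mult_le) (auto simp: abs_le_iff)
  have c1sl: "\<bar>c1 * sigma_l u x0 h\<bar> \<le> 1 * (2 * M)"
    using c sl by (intro abs_mult_le) auto
  have "\<bar>(sigma_r u x0 h + sigma_l u x0 h - 2 * (c1 * sigma_l u x0 h)) / 2\<bar> \<le> 4 * M"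
    using sl sr c1sl by (simp add: abs_le_iff)
  then have A4: "\<bar>(sigma_r u x0 h + sigma_l u x0 h - 2 * (c1 * sigma_l u x0 h)) / 2 * t\<bar>
      \<le> 4 * M * (3/2)"
    using t by (rule abs_mult_le)
  have "\<bar>(sigma_r u x0 h - sigma_l u x0 h) / 2\<bar> \<le> 2 * M"
    using sl sr by (simp add: abs_le_iff)
  then have A5: "\<bar>(sigma_r u x0 h - sigma_l u x0 h) / 2 * t\<^sup>2\<bar> \<le> 2 * M * (9/4)"
    using t2 by (rule abs_mult_le)
  have triangle: "\<bar>p + q - r + v + w\<bar> \<le> b1 + b2 + b3 + b4 + b5"
    if "\<bar>p\<bar> \<le> b1" "\<bar>q\<bar> \<le> b2" "\<bar>r\<bar> \<le> b3" "\<bar>v\<bar> \<le> b4" "\<bar>w\<bar> \<le> b5"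
    for p q r v w b1 b2 b3 b4 b5 :: real
    using that by linarith
  have "\<bar>A\<bar> \<le> 1 * M + 1 * M + 1/24 * (4 * M) + 4 * M * (3/2) + 2 * M * (9/4)"
    unfolding A_def by (rule triangle[OF A1 A2 A3 A4 A5])
  also have "\<dots> \<le> 14 * M" using sl by simp
  finally have "\<bar>A\<bar> \<le> 14 * M" .
  moreover have "\<bar>1 / c2\<bar> \<le> 1 / a" using c by (simp add: frac_le)
  ultimately have "\<bar>1 / c2 * A\<bar> \<le> 1 / a * (14 * M)" by (intro abs_mult_le)
  then show ?thesis by (simp add: eq)
qed

text \<open>If \<open>\<gamma>1 > 0\<close>, then \<open>c2\<close> tends to \<open>1\<close>. If \<open>\<gamma>1 = 0\<close>, then \<open>c2\<close> stays strictly below \<open>1 - K1\<close>,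
  so its positivity at a single \<open>h > 0\<close> already forces \<open>K1 < 1\<close>, and \<open>1 - K1\<close> is its limit.\<close>

lemma c2_bounded_below:
  fixes K0 K1 \<gamma>0 \<gamma>1 :: real
  assumes "K0 > 0" "\<gamma>0 > 0" "\<gamma>1 \<ge> 0"
    and pos: "\<forall>\<^sub>F h in at_right 0. 1 - K0 * h powr \<gamma>0 - K1 * h powr \<gamma>1 > 0"
  obtains a where "a > 0" "\<forall>\<^sub>F h in at_right 0. 1 - K0 * h powr \<gamma>0 - K1 * h powr \<gamma>1 \<ge> a"
proof -
  have h_pos: "\<forall>\<^sub>F h in at_right 0. (h::real) > 0" by (rule eventually_at_right_less)
  have powr_0: "((\<lambda>h::real. h powr g) \<longlongrightarrow> 0) (at_right 0)" if "g > 0" for g :: real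
    using that by (auto intro!: tendsto_zero_powrI eventually_mono[OF h_pos] tendsto_ident_at)
  have "\<exists>L>0. ((\<lambda>h. 1 - K0 * h powr \<gamma>0 - K1 * h powr \<gamma>1) \<longlongrightarrow> L) (at_right 0)"
  proof (cases "\<gamma>1 = 0")
    case False
    then have "((\<lambda>h. 1 - K0 * h powr \<gamma>0 - K1 * h powr \<gamma>1) \<longlongrightarrow> 1 - K0 * 0 - K1 * 0) (at_right 0)"
      using assms by (intro tendsto_intros powr_0) auto
    then show ?thesis by (intro exI[of _ 1]) auto
  next
    case True
    have "\<exists>h. h > 0 \<and> 1 - K0 * h powr \<gamma>0 - K1 * h powr \<gamma>1 > 0"
      by (rule eventually_happens'[OF _ eventually_conj[OF h_pos pos]]) simp
    then obtain h :: real where h: "h > 0" "1 - K0 * h powr \<gamma>0 - K1 * h powr \<gamma>1 > 0" by blast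
    have "K0 * h powr \<gamma>0 > 0" using h assms by simp
    then have "1 - K1 > 0" using h True by simp
    moreover have "((\<lambda>h. 1 - K0 * h powr \<gamma>0 - K1) \<longlongrightarrow> 1 - K0 * 0 - K1) (at_right 0)"
      using assms by (intro tendsto_intros powr_0)
    then have "((\<lambda>h. 1 - K0 * h powr \<gamma>0 - K1 * h powr \<gamma>1) \<longlongrightarrow> 1 - K0 * 0 - K1) (at_right 0)"
      by (rule Lim_transform_eventually) (use h_pos in eventually_elim, simp add: True)
    ultimately show ?thesis by (intro exI[of _ "1 - K1"]) simp
  qed
  then obtain L where L: "L > 0" "((\<lambda>h. 1 - K0 * h powr \<gamma>0 - K1 * h powr \<gamma>1) \<longlongrightarrow> L) (at_right 0)"
    by blast
  have "\<forall>\<^sub>F h in at_right 0. 1 - K0 * h powr \<gamma>0 - K1 * h powr \<gamma>1 > L / 2"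
    using order_tendstoD(1)[OF L(2), of "L / 2"] L(1) by simp
  then show ?thesis using L(1)
    by (intro that[of "L / 2"]) (auto elim: eventually_mono)
qed

section \<open>Accuracy of the weighted reconstruction\<close>

lemma convex_combination_error:
  fixes w0 w1 w2 v p0 p1 p2 :: real
  assumes "0 \<le> w0" "0 \<le> w1" "0 \<le> w2" "w0 + w1 + w2 = 1"
    and "\<bar>v - p0\<bar> \<le> e0" "\<bar>v - p1\<bar> \<le> e1" "\<bar>v - p2\<bar> \<le> e2"
  shows "\<bar>v - (w0 * p0 + w1 * p1 + w2 * p2)\<bar> \<le> e0 + w1 * e1 + w2 * e2"
proof -
  have "v - (w0 * p0 + w1 * p1 + w2 * p2)
      = (w0 + w1 + w2) * v - (w0 * p0 + w1 * p1 + w2 * p2)"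
    using assms(4) by simp
  also have "\<dots> = w0 * (v - p0) + w1 * (v - p1) + w2 * (v - p2)"
    by (simp add: algebra_simps)
  finally have eq: "v - (w0 * p0 + w1 * p1 + w2 * p2)
      = w0 * (v - p0) + w1 * (v - p1) + w2 * (v - p2)" .
  have "\<bar>w0 * (v - p0)\<bar> \<le> 1 * e0" using assms by (intro abs_mult_le) auto
  moreover have "\<bar>w1 * (v - p1)\<bar> \<le> w1 * e1" using assms by (intro abs_mult_le) auto
  moreover have "\<bar>w2 * (v - p2)\<bar> \<le> w2 * e2" using assms by (intro abs_mult_le) auto
  ultimately show ?thesis unfolding eq by linarith
qed

text \<open>A convex combination inherits the first-order accuracy of one of its members as soon as the
  others have bounded error and weight \<open>O(h)\<close>.\<close>

lemma reconstruction_error_uniform_bigo: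
  fixes \<omega>0 \<omega>1 \<omega>2 :: "real \<Rightarrow> real" and p0 p1 p2 :: "real \<Rightarrow> real \<Rightarrow> real"
  assumes weights: "\<forall>\<^sub>F h in at_right 0. \<omega>0 h \<ge> 0 \<and> \<omega>1 h \<ge> 0 \<and> \<omega>2 h \<ge> 0
                    \<and> \<omega>0 h + \<omega>1 h + \<omega>2 h = 1"
    and w1: "\<omega>1 \<in> O[at_right 0](\<lambda>h. h)" and w2: "\<omega>2 \<in> O[at_right 0](\<lambda>h. h)"
    and e0: "uniform_bigo S (\<lambda>h x. u x - p0 h x) (\<lambda>h. h)"
    and e1: "uniform_bigo S (\<lambda>h x. u x - p1 h x) (\<lambda>h. 1)"
    and e2: "uniform_bigo S (\<lambda>h x. u x - p2 h x) (\<lambda>h. 1)"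
  shows "uniform_bigo S (\<lambda>h x. u x - (\<omega>0 h * p0 h x + \<omega>1 h * p1 h x + \<omega>2 h * p2 h x)) (\<lambda>h. h)"
proof -
  obtain C0 where C0: "\<forall>\<^sub>F h in at_right 0. \<forall>x\<in>S h. \<bar>u x - p0 h x\<bar> \<le> C0 * \<bar>h\<bar>"
    using e0 unfolding uniform_bigo_def by blast
  obtain C1 where C1: "\<forall>\<^sub>F h in at_right 0. \<forall>x\<in>S h. \<bar>u x - p1 h x\<bar> \<le> C1"
    using e1 unfolding uniform_bigo_def by auto
  obtain C2 where C2: "\<forall>\<^sub>F h in at_right 0. \<forall>x\<in>S h. \<bar>u x - p2 h x\<bar> \<le> C2"
    using e2 unfolding uniform_bigo_def by auto
  obtain a1 where a1: "\<forall>\<^sub>F h in at_right 0. norm (\<omega>1 h) \<le> a1 * norm h"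
    using w1 by (elim landau_o.bigE)
  obtain a2 where a2: "\<forall>\<^sub>F h in at_right 0. norm (\<omega>2 h) \<le> a2 * norm h"
    using w2 by (elim landau_o.bigE)
  have "\<forall>\<^sub>F h in at_right 0. \<forall>x\<in>S h.
      \<bar>u x - (\<omega>0 h * p0 h x + \<omega>1 h * p1 h x + \<omega>2 h * p2 h x)\<bar> \<le> (C0 + a1 * C1 + a2 * C2) * \<bar>h\<bar>"
    using weights C0 C1 C2 a1 a2
  proof eventually_elim
    case (elim h)
    show ?case
    proof
      fix x assume x: "x \<in> S h"
      have nonneg: "C1 \<ge> 0" "C2 \<ge> 0" using elim x by force+
      have "\<bar>u x - (\<omega>0 h * p0 h x + \<omega>1 h * p1 h x + \<omega>2 h * p2 h x)\<bar>
          \<le> C0 * \<bar>h\<bar> + \<omega>1 h * C1 + \<omega>2 h * C2"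
        using elim x by (intro convex_combination_error) auto
      also have "\<dots> \<le> C0 * \<bar>h\<bar> + (a1 * \<bar>h\<bar>) * C1 + (a2 * \<bar>h\<bar>) * C2"
        using elim nonneg by (intro add_mono mult_right_mono) auto
      also have "\<dots> = (C0 + a1 * C1 + a2 * C2) * \<bar>h\<bar>" by (simp add: algebra_simps)
      finally show "\<bar>u x - (\<omega>0 h * p0 h x + \<omega>1 h * p1 h x + \<omega>2 h * p2 h x)\<bar>
          \<le> (C0 + a1 * C1 + a2 * C2) * \<bar>h\<bar>" .
    qed
  qed
  then show ?thesis unfolding uniform_bigo_def by blast
qed

theorem theorem2p3:
  fixes u :: "real \<Rightarrow> real" and xs :: real and k :: nat
    and x0 :: "real \<Rightarrow> real"
    and K0 K1 \<gamma>0 \<gamma>1 :: real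
    and c0 c1 c2 :: "real \<Rightarrow> real"
    and \<omega>0 \<omega>1 \<omega>2 :: "real \<Rightarrow> real"
    and P :: "real \<Rightarrow> real \<Rightarrow> real"
  assumes "K0 > 0" and "K1 > 0" and "\<gamma>0 \<ge> 0" and "\<gamma>1 \<ge> 0" and "\<gamma>0 \<ge> \<gamma>1" and "\<gamma>0 \<ge> 1"
    and c0_eq: "\<And>h. c0 h = K0 * h powr \<gamma>0"
    and c1_eq: "\<And>h. c1 h = K1 * h powr \<gamma>1"
    and c2_eq: "\<And>h. c2 h = 1 - K0 * h powr \<gamma>0 - K1 * h powr \<gamma>1"
    and c_pos: "\<forall>\<^sub>F h in at_right 0. c0 h > 0 \<and> c1 h > 0 \<and> c2 h > 0"
    and P_eq: "\<And>h x. P h x = \<omega>0 h * P0 u (x0 h) h x + \<omega>1 h * P1 u (x0 h) h x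
                  + \<omega>2 h * P2 (c0 h) (c1 h) (c2 h) u (x0 h) h x"
    and weights: "\<forall>\<^sub>F h in at_right 0. \<omega>0 h \<ge> 0 \<and> \<omega>1 h \<ge> 0 \<and> \<omega>2 h \<ge> 0
                    \<and> \<omega>0 h + \<omega>1 h + \<omega>2 h = 1"
    and u_bounded: "bounded (range u)"
    and u_jump: "jump_at u xs"
    and k: "k \<ge> 1"
    and u_sides: "\<exists>\<delta>>0. Ck_on k u {xs - \<delta><..<xs} \<and> Ck_on k u {xs<..<xs + \<delta>}"
    and xs_mem: "\<forall>\<^sub>F h in at_right 0. xs \<in> cell (x0 h) h (3/2)"
    and u_smooth: "Ck_uniformly_on k u (\<lambda>h. cell (x0 h) h (1/2))"
    and "\<omega>0 \<in> O[at_right 0](\<lambda>h. 1)"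
    and "\<omega>1 \<in> O[at_right 0](\<lambda>h. h)"
    and "\<omega>2 \<in> O[at_right 0](\<lambda>h. h)"
  shows "uniform_bigo (\<lambda>h. cell (x0 h) h (1/2)) (\<lambda>h x. u x - P h x) (\<lambda>h. h)
    \<and> (Ck_uniformly_on k u (\<lambda>h. {x0 h..<xs}) \<longrightarrow>
         uniform_bigo (\<lambda>h. {x0 h..<xs}) (\<lambda>h x. u x - P h x) (\<lambda>h. h))"
proof -
  have h_pos: "\<forall>\<^sub>F h in at_right 0. (h::real) > 0" by (rule eventually_at_right_less)
  obtain M where M: "\<And>x. \<bar>u x\<bar> \<le> M"
    using u_bounded unfolding bounded_iff by auto
  obtain a where a: "a > 0" "\<forall>\<^sub>F h in at_right 0. c2 h \<ge> a"
  proof (rule c2_bounded_below[of K0 \<gamma>0 \<gamma>1 K1])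
    show "\<forall>\<^sub>F h in at_right 0. 1 - K0 * h powr \<gamma>0 - K1 * h powr \<gamma>1 > 0"
      using c_pos by (auto simp: c2_eq elim: eventually_mono)
  qed (use assms in \<open>auto simp: c2_eq\<close>)

  have e1: "uniform_bigo S (\<lambda>h x. u x - P1 u (x0 h) h x) (\<lambda>h. 1)"
    if S: "\<forall>\<^sub>F h in at_right 0. S h \<subseteq> {x0 h..x0 h + 2 * h}" for S
    unfolding uniform_bigo_def
  proof
    show "\<forall>\<^sub>F h in at_right 0. \<forall>x\<in>S h. \<bar>u x - P1 u (x0 h) h x\<bar> \<le> (M + 4 * M) * \<bar>1\<bar>"
      using h_pos S
    proof eventually_elim
      case (elim h)
      show ?case
      proof
        fix x assume "x \<in> S h"
        then have "\<bar>P1 u (x0 h) h x\<bar> \<le> 4 * M" using elim by (intro P1_bound[OF M]) auto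
        then show "\<bar>u x - P1 u (x0 h) h x\<bar> \<le> (M + 4 * M) * \<bar>1\<bar>" using M[of x] by simp
      qed
    qed
  qed

  have e2: "uniform_bigo S (\<lambda>h x. u x - P2 (c0 h) (c1 h) (c2 h) u (x0 h) h x) (\<lambda>h. 1)"
    if S: "\<forall>\<^sub>F h in at_right 0. S h \<subseteq> {x0 h..x0 h + 2 * h}" for S
    unfolding uniform_bigo_def
  proof
    show "\<forall>\<^sub>F h in at_right 0. \<forall>x\<in>S h.
        \<bar>u x - P2 (c0 h) (c1 h) (c2 h) u (x0 h) h x\<bar> \<le> (M + 14 * M / a) * \<bar>1\<bar>"
      using h_pos S c_pos a(2)
    proof eventually_elim
      case (elim h)
      have "c0 h + c1 h + c2 h = 1" by (simp add: c0_eq c1_eq c2_eq)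
      then have c: "0 \<le> c0 h" "c0 h \<le> 1" "0 \<le> c1 h" "c1 h \<le> 1" using elim by linarith+
      show ?case
      proof
        fix x assume "x \<in> S h"
        then have "\<bar>P2 (c0 h) (c1 h) (c2 h) u (x0 h) h x\<bar> \<le> 14 * M / a"
          using elim c a(1) by (intro P2_bound[OF M]) auto
        then show "\<bar>u x - P2 (c0 h) (c1 h) (c2 h) u (x0 h) h x\<bar> \<le> (M + 14 * M / a) * \<bar>1\<bar>"
          using M[of x] by simp
      qed
    qed
  qed

  have reduce: "uniform_bigo S (\<lambda>h x. u x - P h x) (\<lambda>h. h)"
    if "\<forall>\<^sub>F h in at_right 0. S h \<subseteq> {x0 h..x0 h + 2 * h}"
      and "uniform_bigo S (\<lambda>h x. u x - P0 u (x0 h) h x) (\<lambda>h. h)" for S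
    unfolding P_eq using that assms
    by (intro reconstruction_error_uniform_bigo e1 e2) auto

  obtain B where B: "B \<ge> 0" "\<forall>\<^sub>F h in at_right 0.
      \<forall>x\<in>cell (x0 h) h (1/2). \<forall>y\<in>cell (x0 h) h (1/2). \<bar>u x - u y\<bar> \<le> B * \<bar>x - y\<bar>"
    using Ck_uniformly_on_imp_lipschitz[OF u_smooth k] by (auto simp: cell_def)
  have P0_cell: "\<forall>\<^sub>F h in at_right 0. \<forall>x\<in>cell (x0 h) h (1/2). \<bar>u x - P0 u (x0 h) h x\<bar> \<le> B * h"
    using h_pos B(2)
    by eventually_elim (unfold P0_def, intro ballI cell_avg_near_value, use B(1) in auto)

  have "uniform_bigo (\<lambda>h. cell (x0 h) h (1/2)) (\<lambda>h x. u x - P h x) (\<lambda>h. h)"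
  proof (rule reduce)
    show "\<forall>\<^sub>F h in at_right 0. cell (x0 h) h (1/2) \<subseteq> {x0 h..x0 h + 2 * h}"
      using h_pos by eventually_elim (auto simp: cell_half_eq)
    have "\<forall>\<^sub>F h in at_right 0. \<forall>x\<in>cell (x0 h) h (1/2). \<bar>u x - P0 u (x0 h) h x\<bar> \<le> B * \<bar>h\<bar>"
      using h_pos P0_cell by eventually_elim auto
    then show "uniform_bigo (\<lambda>h. cell (x0 h) h (1/2)) (\<lambda>h x. u x - P0 u (x0 h) h x) (\<lambda>h. h)"
      unfolding uniform_bigo_def by blast
  qed
  moreover have "uniform_bigo (\<lambda>h. {x0 h..<xs}) (\<lambda>h x. u x - P h x) (\<lambda>h. h)"
    if smooth: "Ck_uniformly_on k u (\<lambda>h. {x0 h..<xs})"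
  proof (rule reduce)
    show "\<forall>\<^sub>F h in at_right 0. {x0 h..<xs} \<subseteq> {x0 h..x0 h + 2 * h}"
      using xs_mem by eventually_elim (auto simp: cell_three_halves_eq)
    obtain B' where B': "B' \<ge> 0" "\<forall>\<^sub>F h in at_right 0.
        \<forall>x\<in>{x0 h..<xs}. \<forall>y\<in>{x0 h..<xs}. \<bar>u x - u y\<bar> \<le> B' * \<bar>x - y\<bar>"
      using Ck_uniformly_on_imp_lipschitz[OF smooth k] by auto
    have "\<forall>\<^sub>F h in at_right 0. \<forall>x\<in>{x0 h..<xs}. \<bar>u x - P0 u (x0 h) h x\<bar> \<le> (2 * B' + B) * \<bar>h\<bar>"
      using h_pos xs_mem P0_cell B'(2)
    proof eventually_elim
      case (elim h)
      show ?case
      proof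
        fix x assume x: "x \<in> {x0 h..<xs}"
        \<comment> \<open>The comparison goes through the left grid point, which always lies in both sets on which
            \<open>u\<close> is known to be Lipschitz; the first cell itself need not be contained in
            \<open>{x0 h..<xs}\<close>, since the discontinuity may sit at its right endpoint.\<close>
        have x': "x0 h \<le> x" "x - x0 h \<le> 2 * h"
          using x elim by (auto simp: cell_three_halves_eq)
        have "x0 h \<in> {x0 h..<xs}" using x by simp
        then have "\<bar>u x - u (x0 h)\<bar> \<le> B' * \<bar>x - x0 h\<bar>" using elim(4) x by blast
        also have "\<dots> \<le> B' * (2 * h)" using x' B'(1) by (intro mult_left_mono) auto
        finally have "\<bar>u x - u (x0 h)\<bar> \<le> 2 * B' * h" by simp
        moreover have "\<bar>u (x0 h) - P0 u (x0 h) h x\<bar> \<le> B * h"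
          using elim by (auto simp: cell_half_eq P0_def)
        ultimately show "\<bar>u x - P0 u (x0 h) h x\<bar> \<le> (2 * B' + B) * \<bar>h\<bar>"
          using elim(1) by (simp add: distrib_right)
      qed
    qed
    then show "uniform_bigo (\<lambda>h. {x0 h..<xs}) (\<lambda>h x. u x - P0 u (x0 h) h x) (\<lambda>h. h)"
      unfolding uniform_bigo_def by blast
  qed
  ultimately show ?thesis by blast
qed

end
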